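(* Let $n\ge 0$ be an integer, $\nu\in\mathbb{R}$, and $t\in\mathbb{C}$ with $\Re t>0$. Then the $n$-th derivative with respect to the order of the Bessel function of the first kind is $$\frac{\partial^{n}}{\partial\nu^{n}}J_{\nu}(t)=\frac{1}{\pi}\int_{0}^{\pi}x^{n}\cos\left(t\sin x-\nu x-\frac{\pi}{2}n\right)dx-\frac{1}{\pi}\int_{0}^{\infty}e^{-t\sinh x-\nu x}\,\Im\left[(i\pi-x)^{n}e^{i\pi\nu}\right]dx .$$
   Context: $J_\nu(t)=\left(\frac t2\right)^{\nu}\sum_{k=0}^{\infty}\frac{(-1)^k(t/2)^{2k}}{k!\,\Gamma(\nu+k+1)}$ is the Bessel function of the first kind (principal branch of the power, $1/\Gamma$ taken to be $0$ at the poles of $\Gamma$). $\Re$ and $\Im$ denote real and imaginary parts. *)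

theory Defs
  imports "HOL-Analysis.Analysis"
begin

text \<open>
  \<^const>\<open>powr\<close> on \<^typ>\<open>complex\<close> is the principal branch, except that \<open>0 powr \<nu> = 0\<close> for
  every \<open>\<nu>\<close>; in particular the definition below yields \<open>0\<close> rather than \<open>1\<close> at \<open>\<nu> = t = 0\<close>.
  \<^const>\<open>rGamma\<close> is the entire function \<open>1 / \<Gamma>\<close>, which vanishes at the poles of \<open>\<Gamma>\<close>.
\<close>

definition besselJ :: "complex \<Rightarrow> complex \<Rightarrow> complex" where
  "besselJ \<nu> t =
     (t / 2) powr \<nu> *
     (\<Sum>k. (-1) ^ k * (t / 2) ^ (2 * k) / fact k * rGamma (\<nu> + of_nat k + 1))"

text \<open>
  \<^const>\<open>vector_derivative\<close> is total and unspecified where no derivative exists, so a claim about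
  the value of the \<open>n\<close>-th derivative has to be accompanied by differentiability of the
  derivatives of order less than \<open>n\<close>.
\<close>

definition higher_vector_derivative ::
    "nat \<Rightarrow> (real \<Rightarrow> 'a::real_normed_vector) \<Rightarrow> real \<Rightarrow> 'a" where
  "higher_vector_derivative n f = ((\<lambda>g x. vector_derivative g (at x)) ^^ n) f"

end

theory Submission
  imports Defs "HOL-Complex_Analysis.Complex_Analysis"
begin

text \<open>
  In logarithmic coordinates \<open>u = exp y\<close> the Hankel loop consists of the segment from \<open>-\<i> * pi\<close> to
  \<open>\<i> * pi\<close> and two horizontal half-lines, on which the integrands differ by a constant phase; this
  gives \<open>schlaefli \<alpha> \<beta> \<nu>\<close>. Translating the loop by \<open>s\<close> rescales
  \<open>(\<alpha>, \<beta>)\<close> to \<open>(\<alpha> * exp s, \<beta> * exp (- s))\<close>. With \<open>s = - Ln (t / 2)\<close> the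
  integral for \<open>\<alpha> = \<beta> = t / 2\<close> becomes \<open>(t / 2) powr \<nu>\<close> times the one for \<open>\<alpha> = 1\<close> and
  \<open>\<beta> = (t / 2)\<^sup>2\<close>, whose expansion in powers of \<open>\<beta>\<close> is the Bessel series once
  \<open>schlaefli 1 0 \<nu> = rGamma (\<nu> + 1)\<close>. For \<open>\<nu> < 0\<close> the latter follows by letting \<open>s\<close> tend to
  \<open>- \<infinity>\<close>, where only Euler's integral survives, and from the reflection formula; the functional
  equation extends it to all \<open>\<nu>\<close>. The derivatives in \<open>\<nu>\<close> are then taken under the integral signs,
  all integrands being exponentials in \<open>\<nu>\<close>.
\<close>

section \<open>Decay estimates on the half-line\<close>

lemma set_integrable_exp_decay:
  fixes f :: "real \<Rightarrow> 'a::{banach, second_countable_topology}"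
  assumes "f \<in> borel_measurable borel"
    and "\<And>x. x \<ge> 0 \<Longrightarrow> norm (f x) \<le> C * exp (- x)"
  shows "set_integrable lborel {0..} f"
proof -
  have "set_integrable lborel {0..} (\<lambda>x. exp (- x) :: real)"
    using nonnegative_absolutely_integrable_1[OF integrable_on_exp_minus_to_infinity[of 1 0]]
    by (simp add: set_integrable_def integrable_completion borel_measurable_continuous_on_indicator
        continuous_intros)
  then have "set_integrable lborel {0..} (\<lambda>x. C * exp (- x))"
    by simp
  then show ?thesis
    unfolding set_integrable_def
    by (rule Bochner_Integration.integrable_bound)
      (use assms in \<open>auto simp: indicator_def intro!: order_trans[OF _ abs_ge_self]\<close>)
qed

text \<open>The bound sinh x \<ge> x^2/4 on the half-line lets \<open>\<tau> * sinh x\<close> beat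
  any linear term. Completing the square in \<open>(c + 1) * x - \<tau> * x\<^sup>2 / 4\<close>
  gives the constant; the extra 1 pays for the remaining factor \<open>exp (- x)\<close>.\<close>

lemma exp_neg_sinh_le:
  fixes \<tau> c x :: real
  assumes "\<tau> > 0" "x \<ge> 0"
  shows "exp (- (\<tau> * sinh x) + c * x) \<le> exp ((c + 1)\<^sup>2 / \<tau>) * exp (- x)"
proof -
  have "1 + x + x\<^sup>2 / 2 \<le> exp x"
    using exp_lower_Taylor_quadratic[OF assms(2)] .
  moreover have "exp (- x) \<le> 1"
    using assms by simp
  moreover have "exp x - exp (- x) \<ge> x\<^sup>2 / 2"
    using calculation assms by linarith
  ultimately have "sinh x \<ge> x\<^sup>2 / 4"
    by (simp add: sinh_field_def)
  then have "\<tau> * sinh x \<ge> \<tau> * (x\<^sup>2 / 4)"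
    using assms by (intro mult_left_mono) auto
  moreover have "(c + 1)\<^sup>2 / \<tau> - (c + 1) * x + \<tau> * (x\<^sup>2 / 4) = ((c + 1) - \<tau> * x / 2)\<^sup>2 / \<tau>"
    using assms by (simp add: field_simps power2_eq_square)
  moreover have "((c + 1) - \<tau> * x / 2)\<^sup>2 / \<tau> \<ge> 0"
    using assms by simp
  ultimately have "- (\<tau> * sinh x) + c * x \<le> (c + 1)\<^sup>2 / \<tau> - x"
    by (simp add: algebra_simps)
  then show ?thesis
    by (simp flip: exp_add)
qed

subsection \<open>Differentiation of exponential integrals in a parameter\<close>

text \<open>Since r^n/n! is a single term of the series of exp r, the power of
  \<open>norm (b x)\<close> is absorbed by raising \<open>c\<close> to \<open>c + 1\<close>. This is
  why integrability is assumed for every \<open>c\<close>.\<close>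

lemma integrable_exp_moment:
  fixes a b :: "'a \<Rightarrow> complex"
  assumes [measurable]: "a \<in> borel_measurable M" "b \<in> borel_measurable M"
    and int: "\<And>c::real. integrable M (\<lambda>x. norm (a x) * exp (c * norm (b x)))"
  shows "integrable M (\<lambda>x. norm (a x) * norm (b x) ^ n * exp (c * norm (b x)))"
proof (rule Bochner_Integration.integrable_bound[OF integrable_mult_right[OF int[of "c + 1"], of "fact n"]])
  show "AE x in M. norm (norm (a x) * norm (b x) ^ n * exp (c * norm (b x)))
          \<le> norm (fact n * (norm (a x) * exp ((c + 1) * norm (b x))))"
  proof (rule AE_I2)
    fix x
    have "norm (b x) ^ n / fact n \<le> exp (norm (b x))"
      using sum_le_suminf[OF summable_exp[of "norm (b x)"], of "{n}"]
      by (simp add: exp_def field_simps)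
    then have "norm (b x) ^ n \<le> fact n * exp (norm (b x))"
      by (simp add: field_simps)
    then have "norm (a x) * norm (b x) ^ n * exp (c * norm (b x))
        \<le> norm (a x) * (fact n * exp (norm (b x))) * exp (c * norm (b x))"
      by (intro mult_right_mono mult_left_mono) auto
    also have "\<dots> = fact n * (norm (a x) * exp ((c + 1) * norm (b x)))"
      by (simp add: algebra_simps exp_add)
    finally show "norm (norm (a x) * norm (b x) ^ n * exp (c * norm (b x)))
          \<le> norm (fact n * (norm (a x) * exp ((c + 1) * norm (b x))))"
      by simp
  qed
qed measurable

lemma integrable_exp_param:
  fixes a b :: "'a \<Rightarrow> complex" and \<mu> :: real
  assumes [measurable]: "a \<in> borel_measurable M" "b \<in> borel_measurable M"
    and int: "\<And>c::real. integrable M (\<lambda>x. norm (a x) * exp (c * norm (b x)))"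
  shows "integrable M (\<lambda>x. a x * b x ^ n * exp (of_real \<mu> * b x))"
proof (rule Bochner_Integration.integrable_bound[OF integrable_exp_moment[OF assms, of n "\<bar>\<mu>\<bar>"]])
  show "AE x in M. norm (a x * b x ^ n * exp (of_real \<mu> * b x))
          \<le> norm (norm (a x) * norm (b x) ^ n * exp (\<bar>\<mu>\<bar> * norm (b x)))"
  proof (rule AE_I2)
    fix x
    have "norm (exp (of_real \<mu> * b x)) \<le> exp (\<bar>\<mu>\<bar> * norm (b x))"
      using norm_exp[of "of_real \<mu> * b x"] by (simp add: norm_mult)
    then show "norm (a x * b x ^ n * exp (of_real \<mu> * b x))
          \<le> norm (norm (a x) * norm (b x) ^ n * exp (\<bar>\<mu>\<bar> * norm (b x)))"
      by (simp add: norm_mult norm_power mult_left_mono)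
  qed
qed measurable

text \<open>The first-order Taylor remainder of exp (h b) is at most |h b|^2 exp |b| for |h| \<le>
  1. Integrating it against the amplitude bounds the linearisation error by
  \<open>C * h\<^sup>2\<close>, where \<open>C\<close> is an exponential moment of order n +
  2.\<close>

lemma has_vector_derivative_exp_param:
  fixes a b :: "'a \<Rightarrow> complex" and \<mu> :: real
  assumes [measurable]: "a \<in> borel_measurable M" "b \<in> borel_measurable M"
    and int: "\<And>c::real. integrable M (\<lambda>x. norm (a x) * exp (c * norm (b x)))"
  shows "((\<lambda>\<mu>. LINT x|M. a x * b x ^ n * exp (of_real \<mu> * b x)) has_vector_derivative
           (LINT x|M. a x * b x ^ Suc n * exp (of_real \<mu> * b x))) (at \<mu>)"
proof -
  define F where "F m \<mu> x = a x * b x ^ m * exp (of_real \<mu> * b x)" for m and \<mu> :: real and x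
  define C where "C = (LINT x|M. norm (a x) * norm (b x) ^ (n + 2) * exp ((\<bar>\<mu>\<bar> + 1) * norm (b x)))"
  note mom = integrable_exp_moment[OF assms, of "n + 2" "\<bar>\<mu>\<bar> + 1"]
  have Fi: "integrable M (F m \<mu>)" for m \<mu>
    unfolding F_def[abs_def] by (rule integrable_exp_param[OF assms])
  have bound: "norm ((LINT x|M. F n (\<mu> + h) x) - (LINT x|M. F n \<mu> x) - of_real h * (LINT x|M. F (Suc n) \<mu> x))
      \<le> C * h\<^sup>2" if h: "\<bar>h\<bar> \<le> 1" for h :: real
  proof -
    have "norm ((LINT x|M. F n (\<mu> + h) x) - (LINT x|M. F n \<mu> x) - of_real h * (LINT x|M. F (Suc n) \<mu> x))
       = norm (LINT x|M. F n (\<mu> + h) x - F n \<mu> x - of_real h * F (Suc n) \<mu> x)"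
      using Fi by simp
    also have "\<dots> \<le> (LINT x|M. norm (a x) * norm (b x) ^ (n + 2) * exp ((\<bar>\<mu>\<bar> + 1) * norm (b x)) * h\<^sup>2)"
    proof (rule order_trans[OF integral_norm_bound integral_mono])
      fix x
      \<comment> \<open>The factor \<open>exp (of_real \<mu> * b x)\<close> splits off, so the error
        is \<open>F n \<mu> x\<close> times the remainder of the exponential series after its linear
        term.\<close>
      have "F n (\<mu> + h) x - F n \<mu> x - of_real h * F (Suc n) \<mu> x
          = F n \<mu> x * (exp (of_real h * b x) - (\<Sum>k\<le>1. (of_real h * b x) ^ k / fact k))"
        by (simp add: F_def algebra_simps exp_add)
      moreover have "norm (exp (of_real h * b x) - (\<Sum>k\<le>1. (of_real h * b x) ^ k / fact k))
          \<le> exp (norm (b x)) * (h\<^sup>2 * norm (b x) ^ 2)"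
      proof -
        have "norm (exp (of_real h * b x) - (\<Sum>k\<le>1. (of_real h * b x) ^ k / fact k))
            \<le> exp (norm (of_real h * b x)) * norm (of_real h * b x) ^ Suc 1 / fact 1"
          by (rule Taylor_exp_field)
        also have "\<dots> = exp (norm (of_real h * b x)) * (h\<^sup>2 * norm (b x) ^ 2)"
          by (simp add: norm_mult power2_eq_square algebra_simps)
        also have "\<dots> \<le> exp (norm (b x)) * (h\<^sup>2 * norm (b x) ^ 2)"
          using h by (intro mult_right_mono) (auto simp: norm_mult mult_left_le_one_le)
        finally show ?thesis .
      qed
      moreover have "norm (F n \<mu> x) \<le> norm (a x) * norm (b x) ^ n * exp (\<bar>\<mu>\<bar> * norm (b x))"
        using norm_exp[of "of_real \<mu> * b x"]
        by (simp add: F_def norm_mult norm_power mult_left_mono)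
      ultimately have "norm (F n (\<mu> + h) x - F n \<mu> x - of_real h * F (Suc n) \<mu> x)
          \<le> (norm (a x) * norm (b x) ^ n * exp (\<bar>\<mu>\<bar> * norm (b x))) * (exp (norm (b x)) * (h\<^sup>2 * norm (b x) ^ 2))"
        by (simp only: norm_mult) (intro mult_mono; simp)
      also have "\<dots> = norm (a x) * norm (b x) ^ (n + 2) * exp ((\<bar>\<mu>\<bar> + 1) * norm (b x)) * h\<^sup>2"
        by (simp add: algebra_simps exp_add power_add power2_eq_square)
      finally show "norm (F n (\<mu> + h) x - F n \<mu> x - of_real h * F (Suc n) \<mu> x)
          \<le> norm (a x) * norm (b x) ^ (n + 2) * exp ((\<bar>\<mu>\<bar> + 1) * norm (b x)) * h\<^sup>2" .
    qed (use Fi mom in \<open>auto intro!: Bochner_Integration.integrable_diff integrable_mult_right integrable_mult_left\<close>)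
    also have "\<dots> = C * h\<^sup>2"
      by (simp add: C_def)
    finally show ?thesis .
  qed
  have "(\<lambda>h. norm ((LINT x|M. F n (\<mu> + h) x) - (LINT x|M. F n \<mu> x) - h *\<^sub>R (LINT x|M. F (Suc n) \<mu> x)) / norm h) \<midarrow>0\<rightarrow> 0"
  proof (rule Lim_null_comparison)
    show "\<forall>\<^sub>F h in at (0::real). norm (norm ((LINT x|M. F n (\<mu> + h) x) - (LINT x|M. F n \<mu> x)
        - h *\<^sub>R (LINT x|M. F (Suc n) \<mu> x)) / norm h) \<le> C * \<bar>h\<bar>"
      unfolding eventually_at
    proof (intro exI[of _ 1] conjI ballI impI, simp)
      fix h :: real assume h: "h \<noteq> 0 \<and> dist h 0 < 1"
      then show "norm (norm ((LINT x|M. F n (\<mu> + h) x) - (LINT x|M. F n \<mu> x)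
        - h *\<^sub>R (LINT x|M. F (Suc n) \<mu> x)) / norm h) \<le> C * \<bar>h\<bar>"
        using bound[of h] by (simp add: scaleR_conv_of_real divide_simps power2_eq_square mult.assoc)
    qed
    show "((\<lambda>h. C * \<bar>h\<bar>) \<longlongrightarrow> 0) (at 0)"
      by (rule tendsto_eq_intros refl | simp)+
  qed
  then show ?thesis
    unfolding has_vector_derivative_def has_derivative_at F_def
    by (intro conjI bounded_linear_scaleR_left)
qed

text \<open>The indicator of \<open>S\<close> is absorbed into the amplitude \<open>f\<close>,
  leaving the exponent \<open>b\<close> untouched, which reduces both claims to integrals over the
  whole space.\<close>

lemma
  fixes f b :: "'a \<Rightarrow> complex" and \<mu> :: real
  assumes [measurable]: "f \<in> borel_measurable M" "b \<in> borel_measurable M" "S \<in> sets M"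
    and int: "\<And>c::real. set_integrable M S (\<lambda>x. norm (f x) * exp (c * norm (b x)))"
  shows set_integrable_exp_param: "set_integrable M S (\<lambda>x. f x * b x ^ n * exp (of_real \<mu> * b x))"
    and has_vector_derivative_set_integral_exp_param:
      "((\<lambda>\<mu>. LINT x:S|M. f x * b x ^ n * exp (of_real \<mu> * b x)) has_vector_derivative
         (LINT x:S|M. f x * b x ^ Suc n * exp (of_real \<mu> * b x))) (at \<mu>)"
proof -
  let ?a = "\<lambda>x. indicator S x *\<^sub>R f x"
  have a: "?a \<in> borel_measurable M"
    by measurable
  have int': "integrable M (\<lambda>x. norm (?a x) * exp (c * norm (b x)))" for c
    using int[of c] by (simp add: set_integrable_def mult.assoc)
  show "set_integrable M S (\<lambda>x. f x * b x ^ n * exp (of_real \<mu> * b x))"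
    using integrable_exp_param[OF a assms(2) int', of n \<mu>] by (simp add: set_integrable_def)
  show "((\<lambda>\<mu>. LINT x:S|M. f x * b x ^ n * exp (of_real \<mu> * b x)) has_vector_derivative
         (LINT x:S|M. f x * b x ^ Suc n * exp (of_real \<mu> * b x))) (at \<mu>)"
    using has_vector_derivative_exp_param[OF a assms(2) int', of n \<mu>]
    by (simp add: set_lebesgue_integral_def)
qed

subsection \<open>Translation of the Hankel loop\<close>

text \<open>With u = exp y this is the integrand exp (\<alpha> u - \<beta>/u) u^(-\<nu>-1) du of the
  loop integral. In the coordinate y it is entire for every real order, so no branch cut
  appears.\<close>

definition schlaefli_kernel :: "complex \<Rightarrow> complex \<Rightarrow> real \<Rightarrow> complex \<Rightarrow> complex" where
  "schlaefli_kernel \<alpha> \<beta> \<nu> y = exp (\<alpha> * exp y - \<beta> * exp (- y) - of_real \<nu> * y)"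

text \<open>This is the loop integral divided by 2 pi i. The half-lines at heights pi and -pi,
  traversed in opposite directions, carry the phases exp (-i \<nu> pi) and exp (i \<nu> pi); their
  difference -2 i sin (\<nu> pi) gives the coefficient of the second integral.\<close>

definition schlaefli :: "complex \<Rightarrow> complex \<Rightarrow> real \<Rightarrow> complex" where
  "schlaefli \<alpha> \<beta> \<nu> =
     (LINT \<theta>:{-pi..pi}|lborel. schlaefli_kernel \<alpha> \<beta> \<nu> (\<i> * of_real \<theta>)) / of_real (2 * pi) -
     of_real (sin (\<nu> * pi) / pi) * (LINT x:{0..}|lborel. schlaefli_kernel (- \<alpha>) (- \<beta>) \<nu> (of_real x))"

lemma schlaefli_kernel_shift:
  "schlaefli_kernel (\<alpha> * exp s) (\<beta> * exp (- s)) \<nu> y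
     = exp (of_real \<nu> * s) * schlaefli_kernel \<alpha> \<beta> \<nu> (s + y)"
  by (simp add: schlaefli_kernel_def mult_exp_exp exp_add algebra_simps flip: exp_add)

text \<open>A shift by i pi in either direction negates exp y and exp (-y), while the term in \<nu>
  contributes the phase. This quasi-periodicity relates the ends of the vertical segment to the
  half-lines.\<close>

lemma schlaefli_kernel_add_pi:
  "schlaefli_kernel \<alpha> \<beta> \<nu> (y + \<i> * of_real pi) = exp (- (\<i> * of_real (\<nu> * pi))) * schlaefli_kernel (- \<alpha>) (- \<beta>) \<nu> y"
  "schlaefli_kernel \<alpha> \<beta> \<nu> (y - \<i> * of_real pi) = exp (\<i> * of_real (\<nu> * pi)) * schlaefli_kernel (- \<alpha>) (- \<beta>) \<nu> y"
proof -
  have 1: "exp (y + \<i> * of_real pi) = - exp y" "exp (- (y + \<i> * of_real pi)) = - exp (- y)"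
    "exp (y - \<i> * of_real pi) = - exp y" "exp (- (y - \<i> * of_real pi)) = - exp (- y)"
    by (simp_all add: exp_add exp_diff exp_minus divide_inverse)
  show "schlaefli_kernel \<alpha> \<beta> \<nu> (y + \<i> * of_real pi) = exp (- (\<i> * of_real (\<nu> * pi))) * schlaefli_kernel (- \<alpha>) (- \<beta>) \<nu> y"
    unfolding schlaefli_kernel_def 1 by (simp add: algebra_simps flip: exp_add)
  show "schlaefli_kernel \<alpha> \<beta> \<nu> (y - \<i> * of_real pi) = exp (\<i> * of_real (\<nu> * pi)) * schlaefli_kernel (- \<alpha>) (- \<beta>) \<nu> y"
    unfolding schlaefli_kernel_def 1 by (simp add: algebra_simps flip: exp_add)
qed

text \<open>The bound sees \<alpha> and \<beta> only through \<delta> and B, so one constant serves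
  a whole compact family of shifts. It follows from exp x \<ge> sinh x and
  \<open>exp_neg_sinh_le\<close>.\<close>

lemma norm_schlaefli_kernel_le:
  assumes "\<delta> > 0" "Re \<alpha> \<ge> \<delta>" "norm \<beta> \<le> B" "x \<ge> 0"
  shows "norm (schlaefli_kernel (- \<alpha>) (- \<beta>) \<nu> (of_real x))
           \<le> exp B * exp ((\<bar>\<nu>\<bar> + 1)\<^sup>2 / \<delta>) * exp (- x)"
proof -
  have "sinh x \<le> exp x"
    using assms by (simp add: sinh_field_def field_simps)
  then have "\<delta> * sinh x \<le> \<delta> * exp x"
    using assms by (intro mult_left_mono) auto
  also have "\<dots> \<le> Re \<alpha> * exp x"
    using assms by (intro mult_right_mono) auto
  finally have 1: "\<delta> * sinh x \<le> Re \<alpha> * exp x" .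
  have "Re \<beta> * exp (- x) \<le> norm \<beta> * 1"
    using assms complex_Re_le_cmod[of \<beta>] by (intro mult_mono) auto
  then have 2: "Re \<beta> * exp (- x) \<le> B"
    using assms by simp
  have 3: "- (\<nu> * x) \<le> \<bar>\<nu>\<bar> * x"
    using assms by (metis abs_ge_minus_self minus_mult_left mult_right_mono)
  have "norm (schlaefli_kernel (- \<alpha>) (- \<beta>) \<nu> (of_real x))
      = exp (- (Re \<alpha> * exp x) + Re \<beta> * exp (- x) - \<nu> * x)"
    by (simp add: schlaefli_kernel_def norm_exp_eq_Re Re_exp Im_exp)
  also have "\<dots> \<le> exp (B + (- (\<delta> * sinh x) + \<bar>\<nu>\<bar> * x))"
    using 1 2 3 by simp
  also have "\<dots> = exp B * exp (- (\<delta> * sinh x) + \<bar>\<nu>\<bar> * x)"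
    by (simp add: exp_add)
  also have "\<dots> \<le> exp B * (exp ((\<bar>\<nu>\<bar> + 1)\<^sup>2 / \<delta>) * exp (- x))"
    using assms by (intro mult_left_mono exp_neg_sinh_le) auto
  finally show ?thesis
    by simp
qed

lemma set_integrable_schlaefli_kernel:
  assumes "Re \<alpha> > 0"
  shows "set_integrable lborel {0..} (\<lambda>x. schlaefli_kernel (- \<alpha>) (- \<beta>) \<nu> (of_real x))"
proof (rule set_integrable_exp_decay)
  show "(\<lambda>x. schlaefli_kernel (- \<alpha>) (- \<beta>) \<nu> (of_real x)) \<in> borel_measurable borel"
    unfolding schlaefli_kernel_def by (intro borel_measurable_continuous_onI continuous_intros)
qed (rule norm_schlaefli_kernel_le[OF assms order_refl order_refl])

lemma schlaefli_kernel_primitive: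
  "\<exists>P. \<forall>z. (P has_field_derivative schlaefli_kernel \<alpha> \<beta> \<nu> z) (at z)"
proof -
  have "schlaefli_kernel \<alpha> \<beta> \<nu> holomorphic_on UNIV"
    unfolding schlaefli_kernel_def by (intro holomorphic_intros)
  from holomorphic_convex_primitive'[OF convex_UNIV open_UNIV this]
  show ?thesis
    by (metis UNIV_I)
qed

text \<open>The factor \<open>c\<close> is the velocity of the path; the values i, -i and 1 cover
  the vertical and horizontal pieces of the loop.\<close>

lemma set_integral_line_FTC:
  fixes P f :: "complex \<Rightarrow> complex"
  assumes P: "\<And>z. (P has_field_derivative f z) (at z)" and "a \<le> b" and f: "continuous_on UNIV f"
  shows "c * (LINT x:{a..b}|lborel. f (s + c * of_real x)) = P (s + c * of_real b) - P (s + c * of_real a)"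
proof -
  have "((\<lambda>x. P (s + c * of_real x)) has_vector_derivative c * f (s + c * of_real x)) (at x within {a..b})" for x
    by (rule has_vector_derivative_at_within)
      (auto intro!: field_vector_diff_chain_at[OF _ P, unfolded o_def] derivative_eq_intros)
  then have "(LINT x:{a..b}|lborel. c * f (s + c * of_real x)) = P (s + c * of_real b) - P (s + c * of_real a)"
    unfolding set_lebesgue_integral_def using assms(2)
    by (intro integral_FTC_Icc continuous_intros continuous_on_compose2[OF f]) auto
  then show ?thesis
    by simp
qed

text \<open>
  The right-hand side integrates over the loop through \<open>0\<close> and the left-hand side, after a factor
  \<open>exp (\<nu> * s)\<close>, over its translate through \<open>s\<close>. In terms of entire primitives \<open>P\<close>, \<open>Q\<close> of the two
  kernels, the dependence on \<open>s\<close> has zero derivative by quasi-periodicity, and \<open>seg\<close> makes the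
  primitives agree at infinity.
\<close>
lemma schlaefli_shift:
  assumes seg: "\<And>z. z \<in> closed_segment 0 s \<Longrightarrow> Re (\<alpha> * exp z) > 0"
  shows "schlaefli (\<alpha> * exp s) (\<beta> * exp (- s)) \<nu> = exp (of_real \<nu> * s) * schlaefli \<alpha> \<beta> \<nu>"
proof -
  let ?K = "schlaefli_kernel \<alpha> \<beta> \<nu>" and ?L = "schlaefli_kernel (- \<alpha>) (- \<beta>) \<nu>"
  obtain P where P: "\<And>z. (P has_field_derivative ?K z) (at z)"
    using schlaefli_kernel_primitive by blast
  obtain Q where Q: "\<And>z. (Q has_field_derivative ?L z) (at z)"
    using schlaefli_kernel_primitive by blast
  have contK: "continuous_on UNIV ?K" and contL: "continuous_on UNIV ?L"
    unfolding schlaefli_kernel_def by (intro continuous_intros)+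
  define A where "A z = (LINT \<theta>:{-pi..pi}|lborel. ?K (z + \<i> * of_real \<theta>))" for z
  define B where "B z = (LINT x:{0..}|lborel. ?L (z + of_real x))" for z
  define q :: complex where "q = of_real (sin (\<nu> * pi) / pi)"
  \<comment> \<open>Formally \<open>B z\<close> is the value of \<open>Q\<close> at infinity minus
    \<open>Q z\<close>. Hence \<open>C z\<close> is the loop quantity
    \<open>A z / of_real (2 * pi) - q * B z\<close> up to a constant.\<close>
  define C where "C z = (P (z + \<i> * of_real pi) - P (z - \<i> * of_real pi)) / (\<i> * of_real (2 * pi)) + q * Q z" for z
  have A: "A z / of_real (2 * pi) = C z - q * Q z" for z
    using set_integral_line_FTC[OF P _ contK, of "-pi" pi \<i> z]
    by (simp add: A_def C_def field_simps)
  have "(C has_field_derivative 0) (at z)" for z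
  proof -
    have P': "((\<lambda>z. P (z + c)) has_field_derivative ?K (z + c)) (at z)" for c
      by (rule iffD1[OF DERIV_shift P])
    have "(C has_field_derivative (?K (z + \<i> * of_real pi) - ?K (z - \<i> * of_real pi)) / (\<i> * of_real (2 * pi)) + q * ?L z) (at z)"
      unfolding C_def using P'[of "\<i> * of_real pi"] P'[of "- (\<i> * of_real pi)"]
      by (intro DERIV_add DERIV_cdivide DERIV_diff DERIV_cmult Q) simp_all
    \<comment> \<open>After division by 2 pi i this is \<open>- q * ?L z\<close>, so the sine
      coefficient \<open>q\<close> is exactly what makes the derivative of \<open>C\<close>
      vanish.\<close>
    moreover have "?K (z + \<i> * of_real pi) - ?K (z - \<i> * of_real pi) = - 2 * \<i> * of_real (sin (\<nu> * pi)) * ?L z"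
    proof -
      have "exp (- (\<i> * w)) - exp (\<i> * w) = - 2 * \<i> * sin w" for w :: complex
        by (simp add: sin_exp_eq)
      then show ?thesis
        unfolding schlaefli_kernel_add_pi
        by (metis left_diff_distrib sin_of_real)
    qed
    ultimately show ?thesis
      by (simp add: q_def field_simps)
  qed
  then have C: "C s = C 0"
    using has_field_derivative_zero_constant[of UNIV C] by (metis UNIV_I convex_UNIV)
  \<comment> \<open>Up to a nonzero constant factor, the kernel translated by \<open>z\<close> is
    the kernel whose coefficients are rescaled by exp z and exp (-z); the known integrability then
    applies to \<open>\<alpha> * exp z\<close>.\<close>
  have int: "set_integrable lborel {0..} (\<lambda>x. ?L (z + of_real x))" if "Re (\<alpha> * exp z) > 0" for z
    using set_integrable_schlaefli_kernel[OF that, of "\<beta> * exp (- z)" \<nu>]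
    using schlaefli_kernel_shift[of "-\<alpha>" z "-\<beta>" \<nu>]
    by simp
  have Blim: "((\<lambda>X. Q (z + of_real X)) \<longlongrightarrow> B z + Q z) at_top" if "Re (\<alpha> * exp z) > 0" for z
  proof -
    have "((\<lambda>X. (LINT x:{0..X}|lborel. ?L (z + of_real x)) + Q z) \<longlongrightarrow> B z + Q z) at_top"
      unfolding B_def
      by (intro tendsto_intros tendsto_set_lebesgue_integral_at_top int that) auto
    moreover have "\<forall>\<^sub>F X in at_top. (LINT x:{0..X}|lborel. ?L (z + of_real x)) + Q z = Q (z + of_real X)"
      using eventually_ge_at_top[of 0]
      by eventually_elim (use set_integral_line_FTC[OF Q _ contL, of 0 _ 1 z] in auto)
    ultimately show ?thesis
      by (rule Lim_transform_eventually)
  qed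
  \<comment> \<open>The two half-lines starting at \<open>0\<close> and \<open>s\<close> end at the
    same value of \<open>Q\<close>: compactness of the segment makes \<open>?L\<close> uniformly
    O(exp (-X)) on its translate by X, and the mean value inequality bounds the difference of
    \<open>Q\<close>.\<close>
  have "((\<lambda>X. Q (s + of_real X) - Q (0 + of_real X)) \<longlongrightarrow> 0) at_top"
  proof -
    have "\<exists>x\<in>closed_segment 0 s. \<forall>y\<in>closed_segment 0 s. Re (\<alpha> * exp x) \<le> Re (\<alpha> * exp y)"
      by (intro continuous_attains_inf compact_segment continuous_intros) auto
    then obtain \<delta> where \<delta>: "\<delta> > 0" "\<And>z. z \<in> closed_segment 0 s \<Longrightarrow> Re (\<alpha> * exp z) \<ge> \<delta>"
      using seg by blast
    have "bounded ((\<lambda>z. \<beta> * exp (- z)) ` closed_segment 0 s)"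
      by (intro compact_imp_bounded compact_continuous_image continuous_intros compact_segment)
    then obtain M where M: "\<And>z. z \<in> closed_segment 0 s \<Longrightarrow> norm (\<beta> * exp (- z)) \<le> M"
      by (auto simp: bounded_iff)
    have "bounded ((\<lambda>z. exp (- (of_real \<nu> * z))) ` closed_segment 0 s)"
      by (intro compact_imp_bounded compact_continuous_image continuous_intros compact_segment)
    then obtain N where N: "\<And>z. z \<in> closed_segment 0 s \<Longrightarrow> norm (exp (- (of_real \<nu> * z))) \<le> N"
      by (auto simp: bounded_iff)
    define D where "D = N * (exp M * exp ((\<bar>\<nu>\<bar> + 1)\<^sup>2 / \<delta>))"
    have bound: "norm (?L (z + of_real X)) \<le> D * exp (- X)" if z: "z \<in> closed_segment 0 s" and X: "X \<ge> 0" for z and X :: real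
    proof -
      have "?L (z + of_real X) = exp (- (of_real \<nu> * z)) * schlaefli_kernel (- (\<alpha> * exp z)) (- (\<beta> * exp (- z))) \<nu> (of_real X)"
        using schlaefli_kernel_shift[of "-\<alpha>" z "-\<beta>" \<nu> "of_real X"] by (simp add: exp_minus)
      then show ?thesis
        using norm_schlaefli_kernel_le[OF \<delta>(1) \<delta>(2)[OF z] M[OF z] X, of \<nu>] N[OF z]
        by (simp add: norm_mult D_def mult.assoc mult_mono')
    qed
    show ?thesis
    proof (rule Lim_null_comparison)
      show "\<forall>\<^sub>F X in at_top. norm (Q (s + of_real X) - Q (0 + of_real X)) \<le> D * exp (- X) * norm s"
        using eventually_ge_at_top[of 0]
      proof eventually_elim
        fix X :: real assume X: "X \<ge> 0"
        have Q': "((\<lambda>z. Q (z + of_real X)) has_field_derivative ?L (z + of_real X)) (at z within closed_segment 0 s)" for z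
          by (rule has_field_derivative_at_within[OF iffD1[OF DERIV_shift Q]])
        have "norm (Q (s + of_real X) - Q (0 + of_real X)) \<le> D * exp (- X) * norm (s - 0)"
          using bound[OF _ X] by (intro field_differentiable_bound[OF _ Q']) auto
        then show "norm (Q (s + of_real X) - Q (0 + of_real X)) \<le> D * exp (- X) * norm s"
          by simp
      qed
      have "((\<lambda>X::real. exp (- X)) \<longlongrightarrow> 0) at_top"
        by (intro filterlim_compose[OF exp_at_bot] filterlim_uminus_at_bot_at_top)
      then show "((\<lambda>X. D * exp (- X) * norm s) \<longlongrightarrow> 0) at_top"
        by (intro tendsto_mult_left_zero tendsto_mult_right_zero)
    qed
  qed
  moreover have "((\<lambda>X. Q (s + of_real X) - Q (0 + of_real X)) \<longlongrightarrow> (B s + Q s) - (B 0 + Q 0)) at_top"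
    by (intro tendsto_diff Blim seg) simp_all
  ultimately have "(B s + Q s) - (B 0 + Q 0) = 0"
    using tendsto_unique trivial_limit_at_top_linorder by blast
  then have B: "B s = B 0 + Q 0 - Q s"
    by (simp add: algebra_simps)
  have "A s / of_real (2 * pi) - q * B s = A 0 / of_real (2 * pi) - q * B 0"
    unfolding A B C by (simp add: algebra_simps)
  moreover have "schlaefli \<alpha> \<beta> \<nu> = A 0 / of_real (2 * pi) - q * B 0"
    by (simp add: schlaefli_def A_def B_def q_def)
  moreover have "schlaefli (\<alpha> * exp s) (\<beta> * exp (- s)) \<nu> = exp (of_real \<nu> * s) * (A s / of_real (2 * pi) - q * B s)"
    using schlaefli_kernel_shift[of "-\<alpha>" s "-\<beta>" \<nu>]
    by (simp add: schlaefli_def A_def B_def q_def schlaefli_kernel_shift algebra_simps)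
  ultimately show ?thesis
    by simp
qed

subsection \<open>Hankel's integral for the reciprocal Gamma function\<close>

text \<open>Euler's integral under the substitution t = exp y, which turns t^(a-1) exp (-t) dt into
  exp (a y - exp y) dy and the half-line into the whole real line.\<close>

lemma
  fixes a :: real
  assumes "a > 0"
  shows integrable_Gamma_exp: "integrable lborel (\<lambda>y::real. exp (a * y - exp y))"
    and Gamma_exp_integral: "(LINT y|lborel. exp (a * y - exp y)) = Gamma a"
proof -
  let ?f = "\<lambda>t::real. t powr (a - 1) / exp t"
  have range: "exp ` (UNIV :: real set) = {0<..}"
    by (auto simp: image_def intro: exp_ln[symmetric])
  have "(?f has_integral Gamma a) {0<..}"
    using Gamma_integral_real[OF assms]
    by (subst (asm) has_integral_spike_set_eq[of _ "{0<..}"]) (auto intro: negligible_subset[of "{0}"])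
  moreover from this have "?f absolutely_integrable_on {0<..}"
    by (intro nonnegative_absolutely_integrable_1) auto
  ultimately have *: "(\<lambda>x. \<bar>exp x\<bar> * ?f (exp x)) absolutely_integrable_on UNIV"
    "integral UNIV (\<lambda>x. \<bar>exp x\<bar> * ?f (exp x)) = Gamma a"
    using has_absolute_integral_change_of_variables_1'[of UNIV exp exp ?f "Gamma a"]
    by (auto simp: range inj_on_def integral_unique intro: DERIV_exp)
  have "(\<lambda>x. \<bar>exp x\<bar> * ?f (exp x)) = (\<lambda>y. exp (a * y - exp y))"
    by (auto simp: powr_def exp_diff algebra_simps exp_add)
  note * = *[unfolded this]
  then show int: "integrable lborel (\<lambda>y::real. exp (a * y - exp y))"
    by (simp add: set_integrable_def integrable_completion borel_measurable_continuous_onI continuous_intros)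
  show "(LINT y|lborel. exp (a * y - exp y)) = Gamma a"
    using set_borel_integral_eq_integral(2)[of UNIV "\<lambda>y::real. exp (a * y - exp y)"] int *
    by (simp add: set_integrable_def set_lebesgue_integral_def)
qed

text \<open>A real shift keeps exp z positive along the segment, and \<beta> = 0 is preserved.
  Putting y = s + x in the tail moves the shift into the lower limit; the left side is free of
  \<open>s\<close>, so \<open>s\<close> may later tend to minus infinity.\<close>

lemma schlaefli_dilate:
  fixes s :: real
  shows "schlaefli 1 0 \<nu> =
    of_real (exp (- (\<nu> * s))) * (LINT \<theta>:{-pi..pi}|lborel. schlaefli_kernel (of_real (exp s)) 0 \<nu> (\<i> * of_real \<theta>)) / of_real (2 * pi) -
    of_real (sin (\<nu> * pi) / pi * (LINT y:{s..}|lborel. exp (- \<nu> * y - exp y)))"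
proof -
  have seg: "Re (1 * exp z) > 0" if "z \<in> closed_segment 0 (complex_of_real s)" for z
  proof -
    have "Im z = 0"
      using that by (auto simp: in_segment)
    then show ?thesis
      by (simp add: Re_exp)
  qed
  have tail: "of_real (exp (- (\<nu> * s))) * (LINT x:{0..}|lborel. schlaefli_kernel (- of_real (exp s)) 0 \<nu> (of_real x))
     = complex_of_real (LINT y:{s..}|lborel. exp (- \<nu> * y - exp y))"
  proof -
    have "complex_of_real (LINT y:{s..}|lborel. exp (- \<nu> * y - exp y))
        = complex_of_real (LINT x|lborel. indicator {s..} (s + x) * exp (- \<nu> * (s + x) - exp (s + x)))"
      unfolding set_lebesgue_integral_def
      by (subst lborel_integral_real_affine[where c = 1 and t = s]) simp_all
    also have "\<dots> = (LINT x|lborel. complex_of_real (indicator {s..} (s + x) * exp (- \<nu> * (s + x) - exp (s + x))))"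
      by (rule integral_complex_of_real[symmetric])
    also have "\<dots> = (LINT x|lborel. of_real (exp (- (\<nu> * s))) * (indicator {0..} x *\<^sub>R schlaefli_kernel (- of_real (exp s)) 0 \<nu> (of_real x)))"
    proof (rule Bochner_Integration.integral_cong[OF refl])
      fix x :: real
      have "complex_of_real (exp (- \<nu> * (s + x) - exp (s + x)))
          = of_real (exp (- (\<nu> * s))) * schlaefli_kernel (- of_real (exp s)) 0 \<nu> (of_real x)"
      proof -
        have "- \<nu> * (s + x) - exp (s + x) = - (\<nu> * s) + (- (exp s * exp x) - \<nu> * x)"
          by (simp add: exp_add algebra_simps)
        then have "exp (- \<nu> * (s + x) - exp (s + x)) = exp (- (\<nu> * s)) * exp (- (exp s * exp x) - \<nu> * x)"
          by (simp only: exp_add)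
        moreover have "complex_of_real (exp (- (exp s * exp x) - \<nu> * x)) = schlaefli_kernel (- of_real (exp s)) 0 \<nu> (of_real x)"
          by (simp add: schlaefli_kernel_def exp_of_real[symmetric])
        ultimately show ?thesis
          by (simp only: of_real_mult)
      qed
      then show "complex_of_real (indicator {s..} (s + x) * exp (- \<nu> * (s + x) - exp (s + x))) =
        of_real (exp (- (\<nu> * s))) * (indicator {0..} x *\<^sub>R schlaefli_kernel (- of_real (exp s)) 0 \<nu> (of_real x))"
        by (auto simp: indicator_def)
    qed
    also have "\<dots> = of_real (exp (- (\<nu> * s))) * (LINT x|lborel. indicator {0..} x *\<^sub>R schlaefli_kernel (- of_real (exp s)) 0 \<nu> (of_real x))"
      by (rule integral_mult_right_zero)
    finally show ?thesis
      by (simp only: set_lebesgue_integral_def)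
  qed
  have "schlaefli (of_real (exp s)) 0 \<nu> = of_real (exp (\<nu> * s)) * schlaefli 1 0 \<nu>"
    using schlaefli_shift[of "of_real s" 1 0 \<nu>, OF seg] by (simp flip: exp_of_real)
  then have "schlaefli 1 0 \<nu> = of_real (exp (- (\<nu> * s))) * schlaefli (of_real (exp s)) 0 \<nu>"
    by (simp add: exp_minus)
  also have "\<dots> = of_real (exp (- (\<nu> * s))) * (LINT \<theta>:{-pi..pi}|lborel. schlaefli_kernel (of_real (exp s)) 0 \<nu> (\<i> * of_real \<theta>)) / of_real (2 * pi) -
    of_real (sin (\<nu> * pi) / pi) * (of_real (exp (- (\<nu> * s))) * (LINT x:{0..}|lborel. schlaefli_kernel (- of_real (exp s)) 0 \<nu> (of_real x)))"
    by (simp add: schlaefli_def algebra_simps)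
  finally show ?thesis
    unfolding tail by simp
qed

text \<open>The shift is s = -n. The real part of the exponent is exp (-n) cos \<theta> \<le> 1, so
  \<open>exp 1\<close> dominates and only the factor from the order survives in the limit.\<close>

lemma schlaefli_dilate_tendsto:
  "(\<lambda>n. LINT \<theta>:{-pi..pi}|lborel. schlaefli_kernel (of_real (exp (- real n))) 0 \<nu> (\<i> * of_real \<theta>))
     \<longlonglongrightarrow> (LINT \<theta>:{-pi..pi}|lborel. exp (- (\<i> * of_real (\<nu> * \<theta>))))"
  unfolding set_lebesgue_integral_def
proof (rule integral_dominated_convergence)
  show "integrable lborel (\<lambda>\<theta>. indicator {-pi..pi} \<theta> * exp 1 :: real)"
    by simp
  have "(\<lambda>n. exp (- real n)) \<longlonglongrightarrow> 0"
    by (intro filterlim_compose[OF exp_at_bot] filterlim_compose[OF filterlim_uminus_at_bot_at_top] filterlim_real_sequentially)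
  then have lim: "(\<lambda>n. schlaefli_kernel (of_real (exp (- real n))) 0 \<nu> y) \<longlonglongrightarrow> schlaefli_kernel (of_real 0) 0 \<nu> y" for y
    unfolding schlaefli_kernel_def by (intro tendsto_intros)
  show "AE \<theta> in lborel. (\<lambda>n. indicat_real {-pi..pi} \<theta> *\<^sub>R schlaefli_kernel (of_real (exp (- real n))) 0 \<nu> (\<i> * of_real \<theta>))
     \<longlonglongrightarrow> indicat_real {-pi..pi} \<theta> *\<^sub>R exp (- (\<i> * of_real (\<nu> * \<theta>)))"
  proof (rule AE_I2)
    fix \<theta>
    have "- (\<i> * complex_of_real (\<nu> * \<theta>)) = of_real 0 * exp (\<i> * of_real \<theta>) - 0 * exp (- (\<i> * of_real \<theta>)) - of_real \<nu> * (\<i> * of_real \<theta>)"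
      by simp
    then show "(\<lambda>n. indicat_real {-pi..pi} \<theta> *\<^sub>R schlaefli_kernel (of_real (exp (- real n))) 0 \<nu> (\<i> * of_real \<theta>))
     \<longlonglongrightarrow> indicat_real {-pi..pi} \<theta> *\<^sub>R exp (- (\<i> * of_real (\<nu> * \<theta>)))"
      using tendsto_scaleR[OF tendsto_const lim, of "indicat_real {-pi..pi} \<theta>" "\<i> * of_real \<theta>"]
      unfolding schlaefli_kernel_def by (simp add: mult_ac)
  qed
  show "AE \<theta> in lborel. norm (indicat_real {-pi..pi} \<theta> *\<^sub>R schlaefli_kernel (of_real (exp (- real n))) 0 \<nu> (\<i> * of_real \<theta>))
      \<le> indicator {-pi..pi} \<theta> * exp 1" for n
  proof (rule AE_I2)
    fix \<theta>
    have "exp (- real n) * cos \<theta> \<le> exp (- real n) * 1"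
      by (intro mult_left_mono) auto
    also have "\<dots> \<le> 1"
      by simp
    finally have "exp (- real n) * cos \<theta> \<le> 1" .
    then show "norm (indicat_real {-pi..pi} \<theta> *\<^sub>R schlaefli_kernel (of_real (exp (- real n))) 0 \<nu> (\<i> * of_real \<theta>))
      \<le> indicator {-pi..pi} \<theta> * exp 1"
      by (auto simp: indicator_def schlaefli_kernel_def norm_exp_eq_Re Re_exp)
  qed
qed (auto simp: schlaefli_kernel_def intro!: borel_measurable_scaleR borel_measurable_indicator
      borel_measurable_continuous_onI continuous_intros)

text \<open>In \<open>schlaefli_dilate\<close> with s = -n the segment term carries exp (\<nu> n),
  which tends to 0 for negative \<nu>, while its integral converges. The tail fills up to Euler's
  integral at -\<nu>, and the reflection formula identifies the result.\<close>

lemma schlaefli_1_0_neg: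
  assumes "\<nu> < 0"
  shows "schlaefli 1 0 \<nu> = rGamma (of_real \<nu> + 1)"
proof -
  let ?h = "\<lambda>y::real. exp (- \<nu> * y - exp y)"
  let ?A = "\<lambda>n. LINT \<theta>:{-pi..pi}|lborel. schlaefli_kernel (of_real (exp (- real n))) 0 \<nu> (\<i> * of_real \<theta>)"
  have int: "integrable lborel ?h" and Gam: "(LINT y|lborel. ?h y) = Gamma (- \<nu>)"
    using integrable_Gamma_exp[of "- \<nu>"] Gamma_exp_integral[of "- \<nu>"] assms by auto
  have "(\<lambda>n. LINT y:{- real n..}|lborel. ?h y) \<longlonglongrightarrow> (LINT y|lborel. ?h y)"
    unfolding set_lebesgue_integral_def
  proof (rule integral_dominated_convergence[OF _ _ int])
    show "AE y in lborel. (\<lambda>n. indicat_real {- real n..} y *\<^sub>R ?h y) \<longlonglongrightarrow> ?h y"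
    proof (intro AE_I2 tendsto_eventually)
      fix y :: real
      have "\<forall>\<^sub>F n in sequentially. real n \<ge> - y"
        using filterlim_real_sequentially by (simp add: filterlim_at_top)
      then show "\<forall>\<^sub>F n in sequentially. indicat_real {- real n..} y *\<^sub>R ?h y = ?h y"
        by eventually_elim auto
    qed
    show "?h \<in> borel_measurable lborel"
      using int by simp
    show "(\<lambda>y. indicat_real {- real n..} y *\<^sub>R ?h y) \<in> borel_measurable lborel" for n
      using int by simp
  qed (auto simp: indicator_def)
  moreover have "(\<lambda>n. exp (- (\<nu> * - real n))) \<longlonglongrightarrow> 0"
    using assms by real_asymp
  ultimately have "(\<lambda>n. of_real (exp (- (\<nu> * - real n))) * ?A n / of_real (2 * pi)
        - of_real (sin (\<nu> * pi) / pi * (LINT y:{- real n..}|lborel. ?h y)))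
      \<longlonglongrightarrow> of_real 0 * (LINT \<theta>:{-pi..pi}|lborel. exp (- (\<i> * of_real (\<nu> * \<theta>)))) / of_real (2 * pi)
          - of_real (sin (\<nu> * pi) / pi * (LINT y|lborel. ?h y))"
    by (intro tendsto_intros schlaefli_dilate_tendsto) simp_all
  then have "schlaefli 1 0 \<nu> = - of_real (sin (\<nu> * pi) / pi * Gamma (- \<nu>))"
    unfolding schlaefli_dilate[symmetric] Gam by (simp add: LIMSEQ_const_iff)
  also have "\<dots> = rGamma (of_real \<nu> + 1)"
  proof -
    have "Gamma (- \<nu>) > 0"
      using assms by (intro Gamma_real_pos) simp
    \<comment> \<open>The reflection formula concerns the product of two \<open>rGamma\<close>
      values; solving it for one of them requires the other to be nonzero.\<close>
    then have "rGamma (complex_of_real (- \<nu>)) \<noteq> 0"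
      unfolding rGamma_complex_of_real by (simp only: rGamma_inverse_Gamma of_real_eq_0_iff) simp
    then have "rGamma (1 - complex_of_real (- \<nu>)) = sin (of_real pi * of_real (- \<nu>)) / of_real pi * Gamma (of_real (- \<nu>))"
      using rGamma_reflection_complex[of "of_real (- \<nu>)"] by (simp add: Gamma_def field_simps)
    then show ?thesis
      by (simp add: Gamma_complex_of_real[symmetric] sin_of_real[symmetric] mult.commute add.commute)
  qed
  finally show ?thesis .
qed

text \<open>At order 0 the recurrence only determines 0 times this value, so it is computed
  directly: the sine removes the tail, and the segment integral tends to 2 pi.\<close>

lemma schlaefli_1_0_zero: "schlaefli 1 0 0 = 1"
proof -
  let ?A = "\<lambda>n. LINT \<theta>:{-pi..pi}|lborel. schlaefli_kernel (of_real (exp (- real n))) 0 0 (\<i> * of_real \<theta>)"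
  have "?A \<longlonglongrightarrow> of_real (2 * pi)"
    using schlaefli_dilate_tendsto[of 0] by (simp add: set_lebesgue_integral_def scaleR_conv_of_real)
  then have "(\<lambda>n. ?A n / of_real (2 * pi)) \<longlonglongrightarrow> of_real (2 * pi) / of_real (2 * pi)"
    by (intro tendsto_intros) simp_all
  moreover have "(\<lambda>n. ?A n / of_real (2 * pi)) = (\<lambda>n. schlaefli 1 0 0)"
    using schlaefli_dilate[of 0 "- real n" for n] by auto
  ultimately show ?thesis
    by (simp add: LIMSEQ_const_iff)
qed

text \<open>Integration by parts along the loop. For \<beta> = 0 the derivative of the kernel of
  order \<nu> combines the kernels of orders \<nu> - 1 and \<nu>. The boundary terms, multiples of
  exp (-1), cancel where the segment meets the half-lines, and those at infinity vanish.\<close>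

lemma schlaefli_1_0_recurrence: "schlaefli 1 0 (\<nu> - 1) = of_real \<nu> * schlaefli 1 0 \<nu>"
proof -
  let ?K = "\<lambda>\<nu> y. schlaefli_kernel 1 0 \<nu> y" and ?L = "\<lambda>\<nu> y. schlaefli_kernel (-1) 0 \<nu> y"
  let ?w = "complex_of_real (\<nu> * pi)"
  have dK: "(?K \<nu> has_field_derivative (?K (\<nu> - 1) z - of_real \<nu> * ?K \<nu> z)) (at z)" for z
  proof -
    have "?K (\<nu> - 1) z = exp z * ?K \<nu> z"
      by (simp add: schlaefli_kernel_def algebra_simps flip: exp_add)
    then show ?thesis
      unfolding schlaefli_kernel_def[abs_def]
      by (auto intro!: derivative_eq_intros simp: algebra_simps)
  qed
  have dL: "(?L \<nu> has_field_derivative (- ?L (\<nu> - 1) z - of_real \<nu> * ?L \<nu> z)) (at z)" for z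
  proof -
    have "?L (\<nu> - 1) z = exp z * ?L \<nu> z"
      by (simp add: schlaefli_kernel_def algebra_simps flip: exp_add)
    then show ?thesis
      unfolding schlaefli_kernel_def[abs_def]
      by (auto intro!: derivative_eq_intros simp: algebra_simps)
  qed
  have cont: "continuous_on UNIV (schlaefli_kernel \<alpha> \<beta> \<nu>)" for \<alpha> \<beta> \<nu>
    unfolding schlaefli_kernel_def by (intro continuous_intros)
  define A where "A \<nu> = (LINT \<theta>:{-pi..pi}|lborel. ?K \<nu> (\<i> * of_real \<theta>))" for \<nu>
  define B where "B \<nu> = (LINT x:{0..}|lborel. ?L \<nu> (of_real x))" for \<nu>
  have intA: "set_integrable lborel {-pi..pi} (\<lambda>\<theta>. ?K \<nu> (\<i> * of_real \<theta>))" for \<nu>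
    by (intro borel_integrable_atLeastAtMost' continuous_on_compose2[OF cont] continuous_intros) auto
  have intB: "set_integrable lborel {0..} (\<lambda>x. ?L \<nu> (of_real x))" for \<nu>
    using set_integrable_schlaefli_kernel[of 1 0 \<nu>] by simp
  then have intB': "set_integrable lborel {0..} (\<lambda>x. - ?L \<nu> (of_real x))" for \<nu>
    by (simp add: set_integrable_def)
  have "\<i> * (A (\<nu> - 1) - of_real \<nu> * A \<nu>)
      = \<i> * (LINT \<theta>:{-pi..pi}|lborel. ?K (\<nu> - 1) (0 + \<i> * of_real \<theta>) - of_real \<nu> * ?K \<nu> (0 + \<i> * of_real \<theta>))"
    using intA by (simp add: A_def)
  also have "\<dots> = ?K \<nu> (0 + \<i> * of_real pi) - ?K \<nu> (0 + \<i> * of_real (- pi))"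
    by (rule set_integral_line_FTC[OF dK]) (auto intro!: continuous_intros cont)
  also have "\<dots> = (exp (- (\<i> * ?w)) - exp (\<i> * ?w)) * exp (- 1)"
    using schlaefli_kernel_add_pi[of 1 0 \<nu> 0] by (simp add: schlaefli_kernel_def algebra_simps)
  also have "\<dots> = \<i> * (- 2 * sin ?w * exp (- 1))"
    by (simp add: sin_exp_eq)
  finally have "A (\<nu> - 1) - of_real \<nu> * A \<nu> = - 2 * sin ?w * exp (- 1)"
    by (simp only: mult_cancel_left) simp
  then have A: "A (\<nu> - 1) = of_real \<nu> * A \<nu> - 2 * sin ?w * exp (- 1)"
    by (simp add: algebra_simps)
  have lim: "((\<lambda>X. LINT x:{0..X}|lborel. - ?L (\<nu> - 1) (of_real x) - of_real \<nu> * ?L \<nu> (of_real x))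
      \<longlongrightarrow> (LINT x:{0..}|lborel. - ?L (\<nu> - 1) (of_real x) - of_real \<nu> * ?L \<nu> (of_real x))) at_top"
    by (intro tendsto_set_lebesgue_integral_at_top set_integral_diff(1) set_integrable_mult_right)
       (use intB in \<open>auto simp: set_integrable_def\<close>)
  have ev: "\<forall>\<^sub>F X in at_top. (LINT x:{0..X}|lborel. - ?L (\<nu> - 1) (of_real x) - of_real \<nu> * ?L \<nu> (of_real x))
      = ?L \<nu> (of_real X) - exp (- 1)"
    using eventually_ge_at_top[of 0]
  proof eventually_elim
    case (elim X)
    have "1 * (LINT x:{0..X}|lborel. - ?L (\<nu> - 1) (0 + 1 * of_real x) - of_real \<nu> * ?L \<nu> (0 + 1 * of_real x))
        = ?L \<nu> (0 + 1 * of_real X) - ?L \<nu> (0 + 1 * of_real 0)"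
      using elim by (intro set_integral_line_FTC[OF dL]) (auto intro!: continuous_intros cont)
    then show ?case
      by (simp add: schlaefli_kernel_def)
  qed
  have "((\<lambda>X. ?L \<nu> (of_real X)) \<longlongrightarrow> 0) at_top"
  proof (rule Lim_null_comparison)
    show "\<forall>\<^sub>F X in at_top. norm (?L \<nu> (of_real X)) \<le> exp ((\<bar>\<nu>\<bar> + 1)\<^sup>2) * exp (- X)"
      using eventually_ge_at_top[of 0]
      by eventually_elim (use norm_schlaefli_kernel_le[of 1 1 0 0 _ \<nu>] in simp)
    show "((\<lambda>X. exp ((\<bar>\<nu>\<bar> + 1)\<^sup>2) * exp (- X)) \<longlongrightarrow> 0) at_top"
      by (intro tendsto_mult_right_zero filterlim_compose[OF exp_at_bot] filterlim_uminus_at_bot_at_top)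
  qed
  then have lim0: "((\<lambda>X. ?L \<nu> (of_real X) - exp (- 1)) \<longlongrightarrow> 0 - exp (- 1)) at_top"
    by (intro tendsto_intros)
  \<comment> \<open>The truncated integrals tend to the full integral and, through the primitive
    \<open>?L \<nu>\<close>, to the boundary value at 0 alone.\<close>
  have "(LINT x:{0..}|lborel. - ?L (\<nu> - 1) (of_real x) - of_real \<nu> * ?L \<nu> (of_real x)) = 0 - exp (- 1)"
    by (rule tendsto_unique[OF trivial_limit_at_top_linorder Lim_transform_eventually[OF lim ev] lim0])
  moreover have "(LINT x:{0..}|lborel. - ?L (\<nu> - 1) (of_real x) - of_real \<nu> * ?L \<nu> (of_real x))
      = - B (\<nu> - 1) - of_real \<nu> * B \<nu>"
    unfolding B_def
    by (subst set_integral_diff(2)[OF intB' set_integrable_mult_right[OF intB]]) (simp add: set_lebesgue_integral_def)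
  ultimately have B: "B (\<nu> - 1) = exp (- 1) - of_real \<nu> * B \<nu>"
    by (simp add: algebra_simps)
  have sin: "sin ((\<nu> - 1) * pi) = - sin (\<nu> * pi)"
    by (simp add: algebra_simps sin_diff)
  have S: "schlaefli 1 0 \<nu> = A \<nu> / of_real (2 * pi) - of_real (sin (\<nu> * pi) / pi) * B \<nu>" for \<nu>
    by (simp add: schlaefli_def A_def B_def)
  show ?thesis
    unfolding S A B sin
    by (simp add: field_simps flip: sin_of_real)
qed

text \<open>Both sides satisfy the same recurrence, so agreement for negative orders moves up one
  unit at a time. Each step divides by \<nu>, which leaves \<nu> = 0 to
  \<open>schlaefli_1_0_zero\<close>.\<close>

lemma schlaefli_1_0: "schlaefli 1 0 \<nu> = rGamma (of_real \<nu> + 1)"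
proof -
  have "schlaefli 1 0 \<nu> = rGamma (of_real \<nu> + 1)" if "\<nu> < real m" for m
    using that
  proof (induction m arbitrary: \<nu>)
    case 0
    then show ?case
      using schlaefli_1_0_neg by simp
  next
    case (Suc m)
    then have "of_real \<nu> * schlaefli 1 0 \<nu> = rGamma (of_real (\<nu> - 1) + 1)"
      by (subst schlaefli_1_0_recurrence[symmetric]) auto
    also have "\<dots> = of_real \<nu> * rGamma (of_real \<nu> + 1)"
      using rGamma_plus1[of "complex_of_real \<nu>"] by simp
    finally show ?case
      using schlaefli_1_0_zero by (cases "\<nu> = 0") auto
  qed
  then show ?thesis
    using reals_Archimedean2 by blast
qed

subsection \<open>Schlaefli's integral for the Bessel function\<close>

text \<open>The factor exp (-z exp (-y)) is expanded as a power series; its k-th term contains exp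
  (-k y), which raises the order by k.\<close>

lemma schlaefli_kernel_expand:
  "(\<lambda>k. (- z) ^ k / fact k * schlaefli_kernel \<alpha> 0 (\<nu> + real k) y) sums schlaefli_kernel \<alpha> z \<nu> y"
proof -
  have "(\<lambda>k. (- z * exp (- y)) ^ k /\<^sub>R fact k) sums exp (- z * exp (- y))"
    by (rule exp_converges)
  then have "(\<lambda>k. schlaefli_kernel \<alpha> 0 \<nu> y * ((- z * exp (- y)) ^ k /\<^sub>R fact k))
     sums (schlaefli_kernel \<alpha> 0 \<nu> y * exp (- z * exp (- y)))"
    by (rule sums_mult)
  moreover have "schlaefli_kernel \<alpha> 0 \<nu> y * ((- z * exp (- y)) ^ k /\<^sub>R fact k)
      = (- z) ^ k / fact k * schlaefli_kernel \<alpha> 0 (\<nu> + real k) y" for k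
  proof -
    have "schlaefli_kernel \<alpha> 0 (\<nu> + real k) y = schlaefli_kernel \<alpha> 0 \<nu> y * exp (of_nat k * - y)"
      unfolding schlaefli_kernel_def exp_add[symmetric] by (simp add: algebra_simps)
    also have "exp (of_nat k * - y) = exp (- y) ^ k"
      by (rule exp_of_nat_mult)
    finally show ?thesis
      by (simp only: power_mult_distrib) (simp add: scaleR_conv_of_real divide_inverse mult_ac)
  qed
  moreover have "schlaefli_kernel \<alpha> 0 \<nu> y * exp (- z * exp (- y)) = schlaefli_kernel \<alpha> z \<nu> y"
    unfolding schlaefli_kernel_def exp_add[symmetric] by (simp add: algebra_simps)
  ultimately show ?thesis
    by simp
qed

text \<open>A majorant of product form \<open>c k * g x\<close> makes the integrals of the norms
  summable, which permits termwise integration.\<close>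

lemma sums_set_integral:
  fixes f :: "nat \<Rightarrow> 'a \<Rightarrow> 'b::{banach, second_countable_topology}"
  assumes int: "\<And>k. set_integrable M S (f k)" and g: "set_integrable M S g"
    and le: "\<And>k x. x \<in> S \<Longrightarrow> norm (f k x) \<le> c k * g x" and c: "summable c"
    and sums: "\<And>x. x \<in> S \<Longrightarrow> (\<lambda>k. f k x) sums h x"
  shows "(\<lambda>k. LINT x:S|M. f k x) sums (LINT x:S|M. h x)"
proof -
  let ?f = "\<lambda>k x. indicator S x *\<^sub>R f k x" and ?g = "\<lambda>x. indicator S x *\<^sub>R g x"
  have int': "integrable M (?f k)" for k
    using int by (simp add: set_integrable_def)
  have le': "norm (?f k x) \<le> c k * ?g x" for k x
    using le by (auto simp: indicator_def)
  have sumx: "summable (\<lambda>k. norm (?f k x))" for x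
    by (rule summable_comparison_test[OF _ summable_mult2[OF c, of "?g x"]]) (use le' in auto)
  have summ: "summable (\<lambda>k. LINT x|M. norm (?f k x))"
  proof (rule summable_comparison_test[OF _ summable_mult2[OF c, of "LINT x|M. ?g x"]])
    have "norm (LINT x|M. norm (?f k x)) \<le> c k * (LINT x|M. ?g x)" for k
    proof -
      have "(LINT x|M. norm (?f k x)) \<le> (LINT x|M. c k * ?g x)"
        using int' g le' by (intro integral_mono integrable_norm) (auto simp: set_integrable_def)
      then show ?thesis
        by (simp add: integral_nonneg_AE)
    qed
    then show "\<exists>N. \<forall>n\<ge>N. norm (LINT x|M. norm (?f n x)) \<le> c n * (LINT x|M. ?g x)"
      by blast
  qed
  have "(\<lambda>k. integral\<^sup>L M (?f k)) sums (LINT x|M. (\<Sum>k. ?f k x))"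
    using integral_suminf[OF int' AE_I2[OF sumx] summ] summable_integral[OF int' AE_I2[OF sumx] summ]
    by (simp add: summable_sums)
  moreover have "(\<Sum>k. ?f k x) = indicator S x *\<^sub>R h x" for x
    using sums[of x] by (auto simp: indicator_def sums_iff)
  ultimately show ?thesis
    by (simp add: set_lebesgue_integral_def)
qed

text \<open>Termwise integration of both pieces: every kernel on the segment is bounded by
  \<open>exp 1\<close>, and on the half-line exp (-k x) \<le> 1 lets the kernel of order \<nu>
  dominate all higher ones.\<close>

lemma schlaefli_expand: "(\<lambda>k. (- z) ^ k / fact k * schlaefli 1 0 (\<nu> + real k)) sums schlaefli 1 z \<nu>"
proof -
  have summ: "summable (\<lambda>k. norm z ^ k / fact k * c)" for c
    using summable_mult2[OF summable_exp[of "norm z"], of c] by (simp add: field_simps)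
  have cont: "continuous_on UNIV (schlaefli_kernel \<alpha> \<beta> \<nu>)" for \<alpha> \<beta> \<nu>
    unfolding schlaefli_kernel_def by (intro continuous_intros)
  have "(\<lambda>k. LINT \<theta>:{-pi..pi}|lborel. (- z) ^ k / fact k * schlaefli_kernel 1 0 (\<nu> + real k) (\<i> * of_real \<theta>))
     sums (LINT \<theta>:{-pi..pi}|lborel. schlaefli_kernel 1 z \<nu> (\<i> * of_real \<theta>))"
  proof (rule sums_set_integral[OF _ _ _ summ schlaefli_kernel_expand])
    show "set_integrable lborel {-pi..pi} (\<lambda>\<theta>. (- z) ^ k / fact k * schlaefli_kernel 1 0 (\<nu> + real k) (\<i> * of_real \<theta>))" for k
      by (intro borel_integrable_atLeastAtMost' continuous_intros continuous_on_compose2[OF cont]) auto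
    show "set_integrable lborel {-pi..pi} (\<lambda>\<theta>. 1 :: real)"
      by (intro borel_integrable_atLeastAtMost' continuous_intros)
    show "norm ((- z) ^ k / fact k * schlaefli_kernel 1 0 (\<nu> + real k) (\<i> * of_real \<theta>)) \<le> norm z ^ k / fact k * exp 1 * 1" for k \<theta>
      by (simp add: norm_mult norm_divide norm_power schlaefli_kernel_def norm_exp_eq_Re Re_exp divide_right_mono mult_left_mono)
  qed
  then have 1: "(\<lambda>k. (- z) ^ k / fact k * (LINT \<theta>:{-pi..pi}|lborel. schlaefli_kernel 1 0 (\<nu> + real k) (\<i> * of_real \<theta>)))
     sums (LINT \<theta>:{-pi..pi}|lborel. schlaefli_kernel 1 z \<nu> (\<i> * of_real \<theta>))"
    by simp
  have "(\<lambda>k. LINT x:{0..}|lborel. z ^ k / fact k * schlaefli_kernel (-1) 0 (\<nu> + real k) (of_real x))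
     sums (LINT x:{0..}|lborel. schlaefli_kernel (-1) (- z) \<nu> (of_real x))"
  proof (rule sums_set_integral[where c = "\<lambda>k. norm z ^ k / fact k * 1" and g = "\<lambda>x. norm (schlaefli_kernel (-1) 0 \<nu> (of_real x))"])
    have int: "set_integrable lborel {0..} (\<lambda>x. schlaefli_kernel (-1) 0 \<nu> (of_real x))" for \<nu>
      using set_integrable_schlaefli_kernel[of 1 0 \<nu>] by simp
    show "set_integrable lborel {0..} (\<lambda>x. z ^ k / fact k * schlaefli_kernel (-1) 0 (\<nu> + real k) (of_real x))" for k
      by (rule set_integrable_mult_right[OF int])
    show "set_integrable lborel {0..} (\<lambda>x. norm (schlaefli_kernel (-1) 0 \<nu> (of_real x)))"
      by (rule set_integrable_norm[OF int])
    show "norm (z ^ k / fact k * schlaefli_kernel (-1) 0 (\<nu> + real k) (of_real x))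
        \<le> norm z ^ k / fact k * 1 * norm (schlaefli_kernel (-1) 0 \<nu> (of_real x))" if "x \<in> {0..}" for k and x :: real
    proof -
      have "norm (schlaefli_kernel (-1) 0 (\<nu> + real k) (of_real x)) \<le> norm (schlaefli_kernel (-1) 0 \<nu> (of_real x))"
        using that by (simp add: schlaefli_kernel_def norm_exp_eq_Re distrib_right)
      then show ?thesis
        by (simp add: norm_mult norm_divide norm_power divide_right_mono mult_left_mono)
    qed
    show "summable (\<lambda>k. norm z ^ k / fact k * 1)"
      by (rule summ)
    show "(\<lambda>k. z ^ k / fact k * schlaefli_kernel (-1) 0 (\<nu> + real k) (of_real x)) sums schlaefli_kernel (-1) (- z) \<nu> (of_real x)" for x
      using schlaefli_kernel_expand[of "- z" "-1" \<nu>] by simp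
  qed
  then have 2: "(\<lambda>k. z ^ k / fact k * (LINT x:{0..}|lborel. schlaefli_kernel (-1) 0 (\<nu> + real k) (of_real x)))
     sums (LINT x:{0..}|lborel. schlaefli_kernel (-1) (- z) \<nu> (of_real x))"
    by simp
  \<comment> \<open>The half-line expands in powers of z rather than -z, because both coefficients
    are negated there; the sign of the shifted sine compensates.\<close>
  have sin: "sin ((\<nu> + real k) * pi) = (- 1) ^ k * sin (\<nu> * pi)" for k
    by (simp add: distrib_right sin_add)
  have zk: "z ^ k = (- z) ^ k * (- 1) ^ k" for k
    by (simp flip: power_mult_distrib)
  have eq: "(- z) ^ k / fact k * schlaefli 1 0 (\<nu> + real k) =
      (- z) ^ k / fact k * (LINT \<theta>:{-pi..pi}|lborel. schlaefli_kernel 1 0 (\<nu> + real k) (\<i> * of_real \<theta>)) / of_real (2 * pi) -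
      of_real (sin (\<nu> * pi) / pi) * (z ^ k / fact k * (LINT x:{0..}|lborel. schlaefli_kernel (-1) 0 (\<nu> + real k) (of_real x)))" for k
    unfolding schlaefli_def sin zk by (simp add: right_diff_distrib mult_ac)
  show ?thesis
    unfolding eq schlaefli_def[of 1 z]
    by (intro sums_diff sums_divide sums_mult 1 2)
qed

lemma besselJ_eq_schlaefli:
  assumes "Re t > 0"
  shows "besselJ (of_real \<nu>) t = schlaefli (t / 2) (t / 2) \<nu>"
proof -
  define u where "u = t / 2"
  have u: "Re u > 0" "u \<noteq> 0"
    using assms by (auto simp: u_def)
  \<comment> \<open>Along the segment the point u exp z is a power of u with exponent in [0, 1], so
    its argument stays strictly between -pi/2 and pi/2. Here the assumption Re t > 0 enters.\<close>
  have seg: "Re (u * exp z) > 0" if z: "z \<in> closed_segment 0 (- Ln u)" for z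
  proof -
    obtain l where l: "0 \<le> l" "l \<le> 1" "z = (1 - l) *\<^sub>R 0 + l *\<^sub>R (- Ln u)"
      using z by (auto simp only: in_segment)
    have "u * exp z = exp (of_real (1 - l) * Ln u)"
      using u by (simp add: l(3) scaleR_conv_of_real left_diff_distrib exp_diff exp_minus divide_inverse)
    moreover have "\<bar>(1 - l) * Im (Ln u)\<bar> < pi / 2"
    proof -
      have "\<bar>(1 - l) * Im (Ln u)\<bar> \<le> 1 * \<bar>Im (Ln u)\<bar>"
        unfolding abs_mult using l by (intro mult_right_mono) auto
      also have "\<dots> < pi / 2"
        using u Re_Ln_pos_lt by simp
      finally show ?thesis .
    qed
    then have "cos ((1 - l) * Im (Ln u)) > 0"
      by (intro cos_gt_zero_pi) auto
    ultimately show ?thesis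
      by (simp add: Re_exp)
  qed
  have "schlaefli 1 (u ^ 2) \<nu> = exp (- (of_real \<nu> * Ln u)) * schlaefli u u \<nu>"
    using schlaefli_shift[of "- Ln u" u u \<nu>, OF seg] u by (simp add: exp_minus power2_eq_square)
  then have "schlaefli u u \<nu> = u powr of_real \<nu> * schlaefli 1 (u ^ 2) \<nu>"
    using u by (simp add: powr_def exp_minus)
  moreover have "(\<lambda>k. (- 1) ^ k * u ^ (2 * k) / fact k * rGamma (of_real \<nu> + of_nat k + 1)) sums schlaefli 1 (u ^ 2) \<nu>"
    using schlaefli_expand[of "u ^ 2" \<nu>] by (simp add: schlaefli_1_0 power_minus[of "u ^ 2"] power_mult)
  ultimately show ?thesis
    by (simp add: besselJ_def u_def sums_iff)
qed

subsection \<open>Derivatives with respect to the order\<close>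

text \<open>The hypotheses hold at every point, so each iterate is identified as a function and can
  be differentiated again.\<close>

lemma higher_vector_derivative_eqI:
  assumes "\<And>x. f x = F 0 x"
    and deriv: "\<And>k x. (F k has_vector_derivative F (Suc k) x) (at x)"
  shows "higher_vector_derivative n f = F n"
proof (induction n)
  case 0
  then show ?case
    using assms(1) by (auto simp: higher_vector_derivative_def)
next
  case (Suc n)
  then show ?case
    using vector_derivative_at[OF deriv] by (simp add: higher_vector_derivative_def)
qed

text \<open>In Euler's formula the phase pi n / 2 becomes (-i)^n or i^n and merges with x^n. The
  result has the form a b^n exp (\<nu> b) with b = -i x or i x, where differentiation in \<nu> only
  raises n.\<close>

lemma power_mult_cos_conv_exp:
  fixes t :: complex
  shows "of_real x ^ n * cos (t * of_real (sin x) - of_real (\<nu> * x) - of_real (pi / 2 * real n)) =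
    (exp (\<i> * (t * of_real (sin x))) * (- (\<i> * of_real x)) ^ n * exp (of_real \<nu> * - (\<i> * of_real x)) +
     exp (- (\<i> * (t * of_real (sin x)))) * (\<i> * of_real x) ^ n * exp (of_real \<nu> * (\<i> * of_real x))) / 2"
proof -
  let ?w = "t * of_real (sin x) - of_real (\<nu> * x) - of_real (pi / 2 * real n)"
  have i: "exp (of_nat n * (- (\<i> * of_real (pi / 2)))) = (- \<i>) ^ n" "exp (of_nat n * (\<i> * of_real (pi / 2))) = \<i> ^ n"
  proof -
    have "exp (\<i> * of_real (pi / 2)) = \<i>"
      by (metis cis_conv_exp cis_pi_half)
    then show "exp (of_nat n * (- (\<i> * of_real (pi / 2)))) = (- \<i>) ^ n" "exp (of_nat n * (\<i> * of_real (pi / 2))) = \<i> ^ n"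
      unfolding exp_of_nat_mult exp_minus by simp_all
  qed
  have "\<i> * ?w = \<i> * (t * of_real (sin x)) + of_real \<nu> * - (\<i> * of_real x) + of_nat n * (- (\<i> * of_real (pi / 2)))"
    by (simp add: algebra_simps)
  then have 1: "exp (\<i> * ?w) = exp (\<i> * (t * of_real (sin x))) * exp (of_real \<nu> * - (\<i> * of_real x)) * (- \<i>) ^ n"
    by (simp only: exp_add i)
  have "- (\<i> * ?w) = - (\<i> * (t * of_real (sin x))) + of_real \<nu> * (\<i> * of_real x) + of_nat n * (\<i> * of_real (pi / 2))"
    by (simp add: algebra_simps)
  then have 2: "exp (- (\<i> * ?w)) = exp (- (\<i> * (t * of_real (sin x)))) * exp (of_real \<nu> * (\<i> * of_real x)) * \<i> ^ n"
    by (simp only: exp_add i)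
  have p: "(- (\<i> * of_real x)) ^ n = (- \<i>) ^ n * of_real x ^ n" "(\<i> * of_real x) ^ n = \<i> ^ n * of_real x ^ n"
    by (simp_all flip: power_mult_distrib)
  show ?thesis
    unfolding cos_exp_eq 1 2 p by (simp add: field_simps)
qed

text \<open>Writing Im z as (z - cnj z) / (2 i) yields two terms a b^n exp (\<nu> b) with b = i pi -
  x and b = -i pi - x.\<close>

lemma exp_mult_Im_conv_exp:
  fixes t :: complex
  shows "exp (- t * of_real (sinh x) - of_real (\<nu> * x)) *
      of_real (Im ((\<i> * of_real pi - of_real x) ^ n * exp (\<i> * of_real pi * of_real \<nu>))) =
    (exp (- (t * of_real (sinh x))) * (\<i> * of_real pi - of_real x) ^ n * exp (of_real \<nu> * (\<i> * of_real pi - of_real x)) -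
     exp (- (t * of_real (sinh x))) * (- (\<i> * of_real pi) - of_real x) ^ n * exp (of_real \<nu> * (- (\<i> * of_real pi) - of_real x))) / (2 * \<i>)"
proof -
  let ?z = "(\<i> * of_real pi - of_real x) ^ n * exp (\<i> * of_real pi * of_real \<nu>)"
  have Im: "of_real (Im z) = (z - cnj z) / (2 * \<i>)" for z
    by (simp add: complex_eq_iff)
  have cnj: "cnj ?z = (- (\<i> * of_real pi) - of_real x) ^ n * exp (- (\<i> * of_real pi * of_real \<nu>))"
    by (simp add: exp_cnj)
  have e: "exp (- t * of_real (sinh x) - of_real (\<nu> * x)) = exp (- (t * of_real (sinh x))) * exp (- of_real (\<nu> * x))"
    by (simp flip: exp_add)
  have e': "exp (of_real \<nu> * (\<i> * of_real pi - of_real x)) = exp (\<i> * of_real pi * of_real \<nu>) * exp (- complex_of_real (\<nu> * x))"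
    "exp (of_real \<nu> * (- (\<i> * of_real pi) - of_real x)) = exp (- (\<i> * of_real pi * of_real \<nu>)) * exp (- complex_of_real (\<nu> * x))"
    unfolding exp_add[symmetric] by (rule arg_cong[of _ _ exp], simp add: algebra_simps)+
  show ?thesis
    unfolding Im cnj e e' by (simp add: field_simps)
qed

text \<open>This supplies the integrability hypothesis of the parameter lemmas for b = w - x: the
  norm of b grows at most linearly, and the sinh decay wins for every \<open>c\<close>.\<close>

lemma set_integrable_exp_sinh:
  assumes "Re t > 0"
  shows "set_integrable lborel {0..}
    (\<lambda>x. norm (exp (- (t * of_real (sinh x)))) * exp (c * norm (w - complex_of_real x)))"
proof (rule set_integrable_exp_decay)
  show "(\<lambda>x. norm (exp (- (t * of_real (sinh x)))) * exp (c * norm (w - complex_of_real x))) \<in> borel_measurable borel"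
    by (intro borel_measurable_continuous_onI continuous_intros)
  fix x :: real assume x: "x \<ge> 0"
  have "c * norm (w - of_real x) \<le> \<bar>c\<bar> * (norm w + x)"
    using norm_triangle_ineq4[of w "of_real x"] x by (intro mult_mono) auto
  then have "norm (exp (- (t * of_real (sinh x)))) * exp (c * norm (w - complex_of_real x))
      \<le> exp (- (Re t * sinh x)) * exp (\<bar>c\<bar> * (norm w + x))"
    by (simp add: norm_exp_eq_Re)
  also have "\<dots> = exp (\<bar>c\<bar> * norm w) * exp (- (Re t * sinh x) + \<bar>c\<bar> * x)"
    by (simp add: algebra_simps flip: exp_add)
  also have "\<dots> \<le> exp (\<bar>c\<bar> * norm w) * (exp ((\<bar>c\<bar> + 1)\<^sup>2 / Re t) * exp (- x))"
    by (intro mult_left_mono exp_neg_sinh_le assms x) auto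
  finally show "norm (norm (exp (- (t * of_real (sinh x)))) * exp (c * norm (w - complex_of_real x)))
      \<le> exp (\<bar>c\<bar> * norm w) * exp ((\<bar>c\<bar> + 1)\<^sup>2 / Re t) * exp (- x)"
    by simp
qed

text \<open>Multiplied by i, both sides are the same difference of values of an entire primitive;
  the paths from 0 in the directions i and -i give the right side.\<close>

lemma set_integral_schlaefli_kernel_fold:
  "(LINT \<theta>:{-pi..pi}|lborel. schlaefli_kernel \<alpha> \<beta> \<nu> (\<i> * of_real \<theta>)) =
    (LINT \<theta>:{0..pi}|lborel. schlaefli_kernel \<alpha> \<beta> \<nu> (\<i> * of_real \<theta>)) +
    (LINT \<theta>:{0..pi}|lborel. schlaefli_kernel \<alpha> \<beta> \<nu> (- (\<i> * of_real \<theta>)))"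
proof -
  let ?K = "schlaefli_kernel \<alpha> \<beta> \<nu>"
  obtain P where P: "\<And>z. (P has_field_derivative ?K z) (at z)"
    using schlaefli_kernel_primitive by blast
  have cont: "continuous_on UNIV ?K"
    unfolding schlaefli_kernel_def by (intro continuous_intros)
  have "\<i> * (LINT \<theta>:{-pi..pi}|lborel. ?K (\<i> * of_real \<theta>)) = P (\<i> * of_real pi) - P (- (\<i> * of_real pi))"
    using set_integral_line_FTC[OF P _ cont, of "- pi" pi \<i> 0] by simp
  also have "\<dots> = \<i> * ((LINT \<theta>:{0..pi}|lborel. ?K (\<i> * of_real \<theta>)) + (LINT \<theta>:{0..pi}|lborel. ?K (- (\<i> * of_real \<theta>))))"
    using set_integral_line_FTC[OF P _ cont, of 0 pi \<i> 0] set_integral_line_FTC[OF P _ cont, of 0 pi "- \<i>" 0]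
    by (simp add: algebra_simps)
  finally show ?thesis
    by simp
qed

theorem mainTheorem1:
  fixes n :: nat and \<nu> :: real and t :: complex
  assumes "Re t > 0"
  shows
    "(\<forall>k<n. \<forall>\<mu>::real.
        higher_vector_derivative k (\<lambda>\<mu>. besselJ (of_real \<mu>) t) differentiable (at \<mu>)) \<and>
     set_integrable lborel {0..pi}
       (\<lambda>x. of_real x ^ n *
            cos (t * of_real (sin x) - of_real (\<nu> * x) - of_real (pi / 2 * real n))) \<and>
     set_integrable lborel {0..}
       (\<lambda>x. exp (- t * of_real (sinh x) - of_real (\<nu> * x)) *
            of_real (Im ((\<i> * of_real pi - of_real x) ^ n * exp (\<i> * of_real pi * of_real \<nu>)))) \<and>
     higher_vector_derivative n (\<lambda>\<mu>. besselJ (of_real \<mu>) t) \<nu> =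
       1 / of_real pi *
         (LINT x:{0..pi}|lborel. of_real x ^ n *
            cos (t * of_real (sin x) - of_real (\<nu> * x) - of_real (pi / 2 * real n))) -
       1 / of_real pi *
         (LINT x:{0..}|lborel. exp (- t * of_real (sinh x) - of_real (\<nu> * x)) *
            of_real (Im ((\<i> * of_real pi - of_real x) ^ n * exp (\<i> * of_real pi * of_real \<nu>))))"
proof -
  \<comment> \<open>\<open>I1\<close> and \<open>I2\<close> are the exponential halves of the cosine
    integral; \<open>I3\<close>, at w = i pi and w = -i pi, gives those of the imaginary part.
    \<open>F n\<close> is the right side of the theorem in these terms, so that differentiation
    replaces \<open>n\<close> by \<open>Suc n\<close>.\<close>
  define I1 where "I1 n \<mu> = (LINT x:{0..pi}|lborel.
    exp (\<i> * (t * of_real (sin x))) * (- (\<i> * of_real x)) ^ n * exp (of_real \<mu> * - (\<i> * of_real x)))" for n and \<mu> :: real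
  define I2 where "I2 n \<mu> = (LINT x:{0..pi}|lborel.
    exp (- (\<i> * (t * of_real (sin x)))) * (\<i> * of_real x) ^ n * exp (of_real \<mu> * (\<i> * of_real x)))" for n and \<mu> :: real
  define I3 where "I3 w n \<mu> = (LINT x:{0..}|lborel.
    exp (- (t * of_real (sinh x))) * (w - of_real x) ^ n * exp (of_real \<mu> * (w - of_real x)))" for w n and \<mu> :: real
  define F where "F n \<mu> = (I1 n \<mu> + I2 n \<mu>) / of_real (2 * pi) -
    (I3 (\<i> * of_real pi) n \<mu> - I3 (- (\<i> * of_real pi)) n \<mu>) / (2 * of_real pi * \<i>)" for n \<mu>

  have int1: "set_integrable lborel {0..pi} (\<lambda>x. norm (exp (\<i> * (t * of_real (sin x)))) * exp (c * norm (- (\<i> * complex_of_real x))))"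
    and int2: "set_integrable lborel {0..pi} (\<lambda>x. norm (exp (- (\<i> * (t * of_real (sin x))))) * exp (c * norm (\<i> * complex_of_real x)))" for c
    by (intro borel_integrable_atLeastAtMost' continuous_intros)+
  have meas: "(\<lambda>x. exp (\<i> * (t * of_real (sin x)))) \<in> borel_measurable lborel"
    "(\<lambda>x. exp (- (\<i> * (t * of_real (sin x))))) \<in> borel_measurable lborel"
    "(\<lambda>x. exp (- (t * of_real (sinh x)))) \<in> borel_measurable lborel"
    "(\<lambda>x. - (\<i> * complex_of_real x)) \<in> borel_measurable lborel"
    "(\<lambda>x. \<i> * complex_of_real x) \<in> borel_measurable lborel"
    "(\<lambda>x. w - complex_of_real x) \<in> borel_measurable lborel"
    "{0..pi} \<in> sets lborel" "{0..} \<in> sets (lborel :: real measure)" for w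
    by (auto intro!: borel_measurable_continuous_onI continuous_intros)
  note param1 = meas(1,4,7) int1 and param2 = meas(2,5,7) int2
    and param3 = meas(3,6,8) set_integrable_exp_sinh[OF assms]

  have "(F k has_vector_derivative F (Suc k) \<mu>) (at \<mu>)" for k \<mu>
  proof -
    have "(I1 k has_vector_derivative I1 (Suc k) \<mu>) (at \<mu>)"
      unfolding I1_def[abs_def] by (rule has_vector_derivative_set_integral_exp_param[OF param1])
    moreover have "(I2 k has_vector_derivative I2 (Suc k) \<mu>) (at \<mu>)"
      unfolding I2_def[abs_def] by (rule has_vector_derivative_set_integral_exp_param[OF param2])
    moreover have "(I3 w k has_vector_derivative I3 w (Suc k) \<mu>) (at \<mu>)" for w
      unfolding I3_def[abs_def] by (rule has_vector_derivative_set_integral_exp_param[OF param3])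
    ultimately show ?thesis
      unfolding F_def[abs_def]
      by (intro has_vector_derivative_diff has_vector_derivative_divide has_vector_derivative_add)
  qed
  note deriv = this

  have cos_int: "set_integrable lborel {0..pi} (\<lambda>x. of_real x ^ n *
      cos (t * of_real (sin x) - of_real (\<nu> * x) - of_real (pi / 2 * real n)))"
    and cos_eq: "(LINT x:{0..pi}|lborel. of_real x ^ n *
      cos (t * of_real (sin x) - of_real (\<nu> * x) - of_real (pi / 2 * real n))) = (I1 n \<nu> + I2 n \<nu>) / 2" for n \<nu>
    unfolding power_mult_cos_conv_exp I1_def I2_def
    using set_integrable_exp_param[OF param1, of n \<nu>] set_integrable_exp_param[OF param2, of n \<nu>]
    by simp_all
  have Im_int: "set_integrable lborel {0..} (\<lambda>x. exp (- t * of_real (sinh x) - of_real (\<nu> * x)) *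
      of_real (Im ((\<i> * of_real pi - of_real x) ^ n * exp (\<i> * of_real pi * of_real \<nu>))))"
    and Im_eq: "(LINT x:{0..}|lborel. exp (- t * of_real (sinh x) - of_real (\<nu> * x)) *
      of_real (Im ((\<i> * of_real pi - of_real x) ^ n * exp (\<i> * of_real pi * of_real \<nu>)))) =
      (I3 (\<i> * of_real pi) n \<nu> - I3 (- (\<i> * of_real pi)) n \<nu>) / (2 * \<i>)" for n \<nu>
    unfolding exp_mult_Im_conv_exp I3_def
    by (intro set_integrable_divide set_integral_diff set_integrable_exp_param[OF param3])
      (simp only: set_integral_divide_zero set_integral_diff(2)[OF set_integrable_exp_param[OF param3] set_integrable_exp_param[OF param3]])

  \<comment> \<open>The case n = 0: for \<alpha> = \<beta> = t/2 the kernel is exp (t sinh y - \<mu>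
    y), and t sinh (i \<theta>) = i t sin \<theta> matches the folded segment with \<open>I1\<close>
    and \<open>I2\<close>.\<close>
  have "besselJ (of_real \<mu>) t = F 0 \<mu>" for \<mu>
  proof -
    have sinh: "t / 2 * exp y - t / 2 * exp (- y) = t * sinh y" for y
      by (simp add: sinh_field_def field_simps)
    have sin: "sinh (\<i> * complex_of_real x) = \<i> * of_real (sin x)" for x
      by (simp add: sinh_conv_sin sin_of_real[symmetric])
    have sinh_real: "sinh (complex_of_real x) = of_real (sinh x)" for x
      by (simp add: sinh_field_def flip: exp_of_real)
    have K: "schlaefli_kernel (t / 2) (t / 2) \<mu> y = exp (t * sinh y - of_real \<mu> * y)"
      "schlaefli_kernel (- (t / 2)) (- (t / 2)) \<mu> y = exp (- (t * sinh y) - of_real \<mu> * y)" for y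
      unfolding schlaefli_kernel_def sinh[symmetric] by simp_all
    have "(LINT \<theta>:{0..pi}|lborel. schlaefli_kernel (t / 2) (t / 2) \<mu> (\<i> * of_real \<theta>)) = I1 0 \<mu>"
      "(LINT \<theta>:{0..pi}|lborel. schlaefli_kernel (t / 2) (t / 2) \<mu> (- (\<i> * of_real \<theta>))) = I2 0 \<mu>"
      unfolding K I1_def I2_def sinh_minus sin by (simp_all add: mult_ac flip: exp_add)
    moreover have "of_real (sin (\<mu> * pi) / pi) *
        (LINT x:{0..}|lborel. schlaefli_kernel (- (t / 2)) (- (t / 2)) \<mu> (of_real x))
      = (I3 (\<i> * of_real pi) 0 \<mu> - I3 (- (\<i> * of_real pi)) 0 \<mu>) / (2 * of_real pi * \<i>)"
    proof -
      \<comment> \<open>At n = 0 the imaginary part does not depend on x and equals the sine in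
        \<open>schlaefli\<close>, so \<open>Im_eq\<close> evaluates the half-line term.\<close>
      have "Im (exp (\<i> * of_real pi * of_real \<mu>)) = sin (\<mu> * pi)"
        by (simp add: Im_exp mult.commute)
      then have "(LINT x:{0..}|lborel. schlaefli_kernel (- (t / 2)) (- (t / 2)) \<mu> (of_real x)) * of_real (sin (\<mu> * pi))
        = (I3 (\<i> * of_real pi) 0 \<mu> - I3 (- (\<i> * of_real pi)) 0 \<mu>) / (2 * \<i>)"
        using Im_eq[of \<mu> 0] unfolding K sinh_real by simp
      then show ?thesis
        by (simp add: field_simps)
    qed
    ultimately show ?thesis
      unfolding besselJ_eq_schlaefli[OF assms] schlaefli_def set_integral_schlaefli_kernel_fold F_def by simp
  qed
  then have higher: "higher_vector_derivative k (\<lambda>\<mu>. besselJ (of_real \<mu>) t) = F k" for k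
    using deriv by (rule higher_vector_derivative_eqI)
  have "F k differentiable (at \<mu>)" for k \<mu>
    using deriv by (rule differentiableI_vector)
  moreover have "F n \<nu> = 1 / of_real pi * ((I1 n \<nu> + I2 n \<nu>) / 2) -
      1 / of_real pi * ((I3 (\<i> * of_real pi) n \<nu> - I3 (- (\<i> * of_real pi)) n \<nu>) / (2 * \<i>))"
    by (simp add: F_def field_simps)
  ultimately show ?thesis
    using cos_int Im_int unfolding higher cos_eq Im_eq by blast
qed

end
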